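(* Let $a,b\geq 1$ be integers with $\gcd(a,b)=1$, and suppose $(a,b)$ is not one of $(29,1)$, $(45,1)$, $(47,1)$, $(50,1)$, $(55,1)$, $(67,1)$, $(73,1)$, $(79,1)$. Then $$g(S(a,b))\geq\frac{1}{24}\left((8a-7)^{3/2}+12a-13\right)+\frac{(a-1)(b-1)}{2}$$ and $$g(S(a,b))\leq\frac{1}{24}\left(\sqrt{3}\,(8a+3)^{3/2}+36a-36-11\sqrt{33}\right)+\frac{(a-1)(b-1)}{2}.$$
   Context: $\mathbb{N}_0=\{0,1,2,\ldots\}$ and $\binom{n}{2}=\frac{n(n-1)}{2}$. For $a,b\in\mathbb{N}_0$, $S(a,b)$ is the submonoid of $(\mathbb{N}_0,+)$ generated by $\left\{na+\binom{n}{2}b : n\in\mathbb{N}_0\right\}$; it is a numerical semigroup (a submonoid of $\mathbb{N}_0$ with finite complement) exactly when $\gcd(a,b)=1$. For a numerical semigroup $S$, the genus $g(S)$ is the cardinality of $\mathbb{N}_0\setminus S$. *)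

theory Defs
  imports Complex_Main
begin

definition submonoid_nat :: "nat set \<Rightarrow> bool" where
  "submonoid_nat M \<longleftrightarrow> 0 \<in> M \<and> (\<forall>x\<in>M. \<forall>y\<in>M. x + y \<in> M)"

definition numerical_semigroup :: "nat set \<Rightarrow> bool" where
  "numerical_semigroup M \<longleftrightarrow> submonoid_nat M \<and> finite (UNIV - M)"

definition S :: "nat \<Rightarrow> nat \<Rightarrow> nat set" where
  "S a b = submonoid_nat hull {n * a + (n choose 2) * b | n. True}"

(* Meaningful only for numerical semigroups: card is 0 on an infinite complement.
   By numerical_semigroup_S_iff below this does not arise for S a b with a, b coprime. *)
definition genus :: "nat set \<Rightarrow> nat" where
  "genus M = card (UNIV - M)"

lemma submonoid_nat_S: "submonoid_nat (S a b)"
  unfolding S_def by (rule hull_in) (auto simp: submonoid_nat_def)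

lemma generator_in_S: "n * a + (n choose 2) * b \<in> S a b"
  unfolding S_def by (rule hull_inc) blast

lemma submonoid_nat_mult:
  assumes "submonoid_nat M" "x \<in> M"
  shows "k * x \<in> M"
  using assms by (induction k) (auto simp: submonoid_nat_def)

lemma numerical_semigroup_S_iff: "numerical_semigroup (S a b) \<longleftrightarrow> gcd a b = 1"
proof
  assume *: "numerical_semigroup (S a b)"
  have dvd: "gcd a b dvd x" if "x \<in> S a b" for x
  proof -
    have "S a b \<subseteq> {x. gcd a b dvd x}"
      unfolding S_def by (rule hull_minimal) (auto simp: submonoid_nat_def)
    with that show ?thesis by auto
  qed
  obtain m where "\<forall>n \<in> UNIV - S a b. n < m"
    using * unfolding numerical_semigroup_def finite_nat_set_iff_bounded by blast
  then have "n \<in> S a b" if "n \<ge> m" for n using that by (meson Diff_iff UNIV_I not_le)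
  then have "m \<in> S a b" "m + 1 \<in> S a b" by simp_all
  then have "gcd a b dvd m" "gcd a b dvd m + 1" using dvd by blast+
  then have "gcd a b dvd 1" using dvd_add_right_iff by blast
  then show "gcd a b = 1" by simp
next
  assume g: "gcd a b = 1"
  have sub: "submonoid_nat (S a b)" by (rule submonoid_nat_S)
  define c where "c = 2 * a + b"
  have a: "a \<in> S a b" using generator_in_S[of 1 a b] by (simp add: binomial_eq_0)
  have c: "c \<in> S a b" using generator_in_S[of 2 a b] by (simp add: c_def)
  have mem: "x * a + y * c \<in> S a b" for x y
    using submonoid_nat_mult[OF sub a, of x] submonoid_nat_mult[OF sub c, of y] sub
    by (auto simp: submonoid_nat_def)
  have "finite (UNIV - S a b)"
  proof (cases "a = 0")
    case True
    then have "c = 1" using g by (simp add: c_def)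
    then have "x \<in> S a b" for x using mem[of 0 x] by simp
    then have "UNIV - S a b = {}" by auto
    then show ?thesis by (metis finite.emptyI)
  next
    case False
    have "gcd a c = 1"
      using g gcd_add_mult[of a 2 b] by (simp add: c_def)
    then obtain u v where uv: "c * u = a * v + 1"
      using bezout_nat[of c a] False by (auto simp: c_def gcd.commute)
    have "x \<in> S a b" if x: "x \<ge> a * c" for x
    proof -
      define y where "y = (u * x) mod a"
      have "c * y \<le> c * a" using False by (simp add: y_def less_imp_le)
      then have le: "c * y \<le> x" using x by (metis le_trans mult.commute)
      have "(c * y) mod a = (c * u * x) mod a"
        by (simp add: y_def mod_mult_right_eq mult.assoc)
      also have "c * u * x = x + a * (v * x)"
        by (simp add: uv algebra_simps)
      also have "(x + a * (v * x)) mod a = x mod a" by simp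
      finally have "a dvd x - c * y"
        using le by (metis mod_eq_dvd_iff_nat)
      then obtain k where "x - c * y = a * k" ..
      then have "x = k * a + y * c" using le by (simp add: mult.commute)
      then show ?thesis using mem by simp
    qed
    then have "UNIV - S a b \<subseteq> {..<a * c}" by (meson DiffD2 lessThan_iff not_le subsetI)
    then show ?thesis using finite_subset by blast
  qed
  with sub show "numerical_semigroup (S a b)" by (simp add: numerical_semigroup_def)
qed

end

theory Submission
  imports Defs "HOL-Number_Theory.Cong"
begin

text \<open>
  Modulo \<open>a\<close> the element \<open>A a + B b\<close> only depends on \<open>B\<close>, so a threshold \<open>l B\<close> on \<open>A\<close> in each
  class \<open>B < a\<close> turns into \<open>l B + b B div a\<close> gaps, and the second terms add up to
  \<open>(a - 1) (b - 1) / 2\<close>. An element of \<open>S a b\<close> has the form \<open>A a + B b\<close> with \<open>B \<le> A choose 2\<close>,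
  which gives the lower bound. For the upper bound it suffices to write \<open>B\<close> as
  a sum of binomials \<open>n choose 2\<close> with \<open>2 \<Sum>n - 3 \<le> sqrt (3 (8 B + 3))\<close>. Gauss's theorem on three triangular
  numbers would give this by Cauchy-Schwarz, but it is avoided: for \<open>B \<ge> 36\<close> one may split off
  the largest binomial and recurse, since the remainder is of order \<open>sqrt B\<close> only.
\<close>

lemma choose_two_real: "real (n choose 2) = real n * (real n - 1) / 2"
  by (cases n) (auto simp: choose_two algebra_simps real_of_nat_div)

lemma choose_two_add: "(m + n) choose 2 = (m choose 2) + (n choose 2) + m * n"
proof -
  have "real ((m + n) choose 2) = real ((m choose 2) + (n choose 2) + m * n)"
    by (simp add: choose_two_real field_simps)
  then show ?thesis using of_nat_eq_iff by blast
qed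

subsection \<open>Counting gaps by residue classes\<close>

text \<open>For \<open>b\<close> coprime to \<open>a\<close> the classes of \<open>b * B\<close>,
  \<open>B < a\<close>, are all residue classes. One set serves both bounds: thresholds
  \<open>l\<close> from below give a subset of the gaps, thresholds from above a superset.\<close>

definition class_gaps :: "nat \<Rightarrow> nat \<Rightarrow> (nat \<Rightarrow> nat) \<Rightarrow> nat set" where
  "class_gaps a b l = {x. \<exists>B<a. [x = b * B] (mod a) \<and> x < l B * a + b * B}"

lemma bij_betw_mult_mod:
  fixes a b :: nat
  assumes "coprime a b" "a \<ge> 1"
  shows "bij_betw (\<lambda>B. (b * B) mod a) {..<a} {..<a}"
proof -
  have "inj_on (\<lambda>B. (b * B) mod a) {..<a}"
  proof (rule inj_onI)
    fix x y assume "x \<in> {..<a}" "y \<in> {..<a}" "b * x mod a = b * y mod a"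
    then have "[x = y] (mod a)"
      using assms cong_mult_lcancel_nat[of b a x y] by (simp add: cong_def coprime_commute)
    then show "x = y" using \<open>x \<in> _\<close> \<open>y \<in> _\<close> by (simp add: cong_def)
  qed
  moreover have "(\<lambda>B. (b * B) mod a) ` {..<a} \<subseteq> {..<a}" using assms by auto
  ultimately show ?thesis
    by (simp add: bij_betw_def endo_inj_surj)
qed

text \<open>Divide each \<open>b * B\<close> by \<open>a\<close> with remainder and sum: the
  remainders permute \<open>0, ..., a - 1\<close>, so the sum of the quotients is
  determined.\<close>

lemma sum_mult_div:
  fixes a b :: nat
  assumes "coprime a b" "a \<ge> 1"
  shows "real (\<Sum>B<a. (b * B) div a) = (real a - 1) * (real b - 1) / 2"
proof -
  have gauss: "real (\<Sum>B<n. B) = real n * (real n - 1) / 2" for n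
    by (induction n) (auto simp: field_simps)
  have "(\<Sum>B<a. b * B) = (\<Sum>B<a. a * ((b * B) div a) + (b * B) mod a)" by simp
  also have "\<dots> = a * (\<Sum>B<a. (b * B) div a) + (\<Sum>B<a. (b * B) mod a)"
    by (simp only: sum.distrib sum_distrib_left)
  also have "(\<Sum>B<a. (b * B) mod a) = (\<Sum>B<a. B)"
    using sum.reindex_bij_betw[OF bij_betw_mult_mod[OF assms], of "\<lambda>x. x"] .
  finally have "b * (\<Sum>B<a. B) = a * (\<Sum>B<a. (b * B) div a) + (\<Sum>B<a. B)"
    by (simp only: sum_distrib_left)
  then have "real b * real (\<Sum>B<a. B) = real a * real (\<Sum>B<a. (b * B) div a) + real (\<Sum>B<a. B)"
    by (simp only: flip: of_nat_mult of_nat_add)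
  then have "real a * real (\<Sum>B<a. (b * B) div a) = real a * ((real a - 1) * (real b - 1) / 2)"
    by (simp add: gauss field_simps del: of_nat_sum)
  then show ?thesis using assms(2) by (simp del: of_nat_sum)
qed

lemma card_class:
  fixes a t :: nat
  assumes "a \<ge> 1"
  shows "finite {x. [x = t] (mod a) \<and> x < l * a + t}"
    and "card {x. [x = t] (mod a) \<and> x < l * a + t} = l + t div a"
proof -
  let ?f = "\<lambda>j. j * a + t mod a"
  \<comment> \<open>Since \<open>l * a + t = (l + t div a) * a + t mod a\<close>, comparing members
    of the class amounts to comparing quotients by \<open>a\<close>.\<close>
  have "{x. [x = t] (mod a) \<and> x < l * a + t} = ?f ` {..<l + t div a}"
  proof (intro equalityI subsetI)
    fix x assume "x \<in> {x. [x = t] (mod a) \<and> x < l * a + t}"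
    then have x: "x mod a = t mod a" "x < l * a + t" by (auto simp: cong_def)
    have "(x div a) * a + t mod a < (l + t div a) * a + t mod a"
      using x by (metis add.assoc add_mult_distrib div_mult_mod_eq)
    then have "x div a < l + t div a" by simp
    moreover have "x = ?f (x div a)" using x by (metis div_mult_mod_eq)
    ultimately show "x \<in> ?f ` {..<l + t div a}" by blast
  next
    fix x assume "x \<in> ?f ` {..<l + t div a}"
    then obtain j where j: "j < l + t div a" "x = j * a + t mod a" by auto
    then have "j * a < (l + t div a) * a" using assms by simp
    then have "x < (l + t div a) * a + t mod a" using j by simp
    also have "\<dots> = l * a + t" by (simp add: add_mult_distrib)
    finally show "x \<in> {x. [x = t] (mod a) \<and> x < l * a + t}"
      using j by (simp add: cong_def)
  qed
  moreover have "inj_on ?f {..<l + t div a}" using assms by (auto simp: inj_on_def)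
  ultimately show "finite {x. [x = t] (mod a) \<and> x < l * a + t}"
    and "card {x. [x = t] (mod a) \<and> x < l * a + t} = l + t div a"
    by (simp_all add: card_image)
qed

lemma class_gaps_finite_card:
  fixes a b :: nat
  assumes "coprime a b" "a \<ge> 1"
  shows "finite (class_gaps a b l)"
    and "real (card (class_gaps a b l)) = (\<Sum>B<a. real (l B)) + (real a - 1) * (real b - 1) / 2"
proof -
  let ?C = "\<lambda>B. {x. [x = b * B] (mod a) \<and> x < l B * a + b * B}"
  have un: "class_gaps a b l = (\<Union>B<a. ?C B)" by (auto simp: class_gaps_def)
  then show "finite (class_gaps a b l)" using card_class[OF assms(2)] by simp
  have "?C B \<inter> ?C B' = {}" if "B < a" "B' < a" "B \<noteq> B'" for B B'
  proof -
    have "(b * B) mod a \<noteq> (b * B') mod a"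
      using inj_onD[OF bij_betw_imp_inj_on[OF bij_betw_mult_mod[OF assms]], of B B'] that by auto
    then show ?thesis by (auto simp: cong_def)
  qed
  then have "card (class_gaps a b l) = (\<Sum>B<a. card (?C B))"
    unfolding un using card_class[OF assms(2)] by (intro card_UN_disjoint) auto
  also have "\<dots> = (\<Sum>B<a. l B) + (\<Sum>B<a. (b * B) div a)"
    by (simp add: card_class[OF assms(2)] sum.distrib)
  finally show "real (card (class_gaps a b l)) = (\<Sum>B<a. real (l B)) + (real a - 1) * (real b - 1) / 2"
    using sum_mult_div[OF assms] by (metis of_nat_add of_nat_sum)
qed

subsection \<open>The lower bound\<close>

text \<open>\<open>n choose 2\<close> is superadditive in \<open>n\<close>, by the cross term in
  \<open>choose_two_add\<close>, so these elements form a submonoid containing the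
  generators.\<close>

lemma S_elem_form:
  assumes "x \<in> S a b"
  obtains A B where "x = A * a + B * b" "B \<le> A choose 2"
proof -
  let ?M = "{A * a + B * b | A B. B \<le> A choose 2}"
  have "submonoid_nat ?M"
    unfolding submonoid_nat_def
  proof (intro conjI ballI)
    show "0 \<in> ?M" by force
    fix x y assume "x \<in> ?M" "y \<in> ?M"
    then obtain A B A' B' where "x = A * a + B * b" "B \<le> A choose 2"
      "y = A' * a + B' * b" "B' \<le> A' choose 2" by blast
    then have "x + y = (A + A') * a + (B + B') * b" "B + B' \<le> (A + A') choose 2"
      by (auto simp: choose_two_add algebra_simps)
    then show "x + y \<in> ?M" by blast
  qed
  then have "S a b \<subseteq> ?M" unfolding S_def by (intro hull_minimal) auto
  with assms that show ?thesis by blast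
qed

definition min_size :: "nat \<Rightarrow> nat" where
  "min_size B = (LEAST A. B \<le> A choose 2)"

lemma le_choose_min_size: "B \<le> min_size B choose 2"
proof -
  have "B \<le> Suc B choose 2"
  proof (induction B)
    case (Suc B)
    then show ?case using choose_two_add[of "Suc B" 1] by (simp add: binomial_eq_0)
  qed simp
  then show ?thesis unfolding min_size_def by (rule LeastI)
qed

lemma min_size_le: "B \<le> A choose 2 \<Longrightarrow> min_size B \<le> A"
  unfolding min_size_def by (rule Least_le)

text \<open>Completing the square, \<open>B <= A choose 2\<close> means
  \<open>8 B + 1 <= (2 A - 1)^2\<close>. At \<open>B = 0\<close> the bound fails, as
  \<open>min_size 0 = 0\<close>.\<close>

lemma min_size_ge:
  assumes "B \<ge> 1"
  shows "real (min_size B) \<ge> (1 + sqrt (8 * real B + 1)) / 2"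
proof -
  define A where "A = min_size B"
  have le: "B \<le> A choose 2" using le_choose_min_size by (simp add: A_def)
  with assms have "A \<noteq> 0" by (intro notI) (simp add: binomial_eq_0)
  have "real B \<le> real (A choose 2)" using le by simp
  then have "8 * real B + 1 \<le> (2 * real A - 1)\<^sup>2"
    by (simp add: choose_two_real power2_eq_square algebra_simps)
  then have "sqrt (8 * real B + 1) \<le> 2 * real A - 1"
    using \<open>A \<noteq> 0\<close> by (intro real_le_lsqrt) auto
  then show ?thesis by (simp add: A_def)
qed

lemma class_gaps_subset:
  assumes "coprime a b"
  shows "class_gaps a b min_size \<subseteq> UNIV - S a b"
proof (intro subsetI DiffI UNIV_I notI)
  fix x assume "x \<in> class_gaps a b min_size" "x \<in> S a b"
  then obtain B A B' where *: "B < a" "[x = b * B] (mod a)" "x < min_size B * a + b * B"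
    and x: "x = A * a + B' * b" "B' \<le> A choose 2"
    using S_elem_form by (auto simp: class_gaps_def) metis
  have "[b * B' = b * B] (mod a)" using *(2) x(1) by (simp add: cong_def mult.commute)
  then have "B' mod a = B"
    using assms \<open>B < a\<close> cong_mult_lcancel_nat[of b a B' B] by (simp add: cong_def coprime_commute)
  \<comment> \<open>\<open>B\<close> is the least natural number in its class modulo
    \<open>a\<close>.\<close>
  then have "B \<le> B'" by auto
  then have "min_size B \<le> A" using x(2) by (intro min_size_le) simp
  then have "min_size B * a + b * B \<le> A * a + B' * b"
    using \<open>B \<le> B'\<close> by (simp add: add_mono mult.commute)
  with *(3) x(1) show False by simp
qed

text \<open>One step of comparing a sum of square roots with the integral of \<open>sqrt (8 x + c)\<close>.\<close>

lemma sqrt_step: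
  fixes x :: real
  assumes "x > 0"
  shows "12 * sqrt x \<le> (x + 8) powr (3/2) - x powr (3/2)"
    and "(x + 8) powr (3/2) - x powr (3/2) \<le> 12 * sqrt (x + 8)"
proof -
  define u v where "u = sqrt x" and "v = sqrt (x + 8)"
  have uv: "0 < u" "u < v" "v\<^sup>2 = u\<^sup>2 + 8" using assms by (auto simp: u_def v_def)
  have p: "y powr (3/2) = sqrt y ^ 3" if "y > 0" for y :: real
    using that by (simp add: powr_half_sqrt[symmetric] powr_power)
  \<comment> \<open>The factor \<open>u + v\<close> turns \<open>v - u\<close> into
    \<open>v^2 - u^2 = 8\<close>; both inequalities then become signs of products with the factor
    \<open>v - u\<close>.\<close>
  have eq: "(u + v) * (v ^ 3 - u ^ 3) = 8 * (v\<^sup>2 + u * v + u\<^sup>2)"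
  proof -
    have "(u + v) * (v ^ 3 - u ^ 3) = (v\<^sup>2 - u\<^sup>2) * (v\<^sup>2 + u * v + u\<^sup>2)"
      by (simp add: algebra_simps power2_eq_square power3_eq_cube)
    then show ?thesis using uv by simp
  qed
  have "(u + v) * (v ^ 3 - u ^ 3 - 12 * u) = 4 * ((2 * v + u) * (v - u))"
    using eq by (simp add: algebra_simps power2_eq_square)
  also have "\<dots> \<ge> 0" using uv by simp
  finally have "12 * u \<le> v ^ 3 - u ^ 3" using uv by (simp add: zero_le_mult_iff)
  then show "12 * sqrt x \<le> (x + 8) powr (3/2) - x powr (3/2)"
    using assms by (simp add: p u_def v_def)
  have "(u + v) * (12 * v - (v ^ 3 - u ^ 3)) = 4 * ((2 * u + v) * (v - u))"
    using eq by (simp add: algebra_simps power2_eq_square)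
  also have "\<dots> \<ge> 0" using uv by simp
  finally have "v ^ 3 - u ^ 3 \<le> 12 * v" using uv by (simp add: zero_le_mult_iff)
  then show "(x + 8) powr (3/2) - x powr (3/2) \<le> 12 * sqrt (x + 8)"
    using assms by (simp add: p u_def v_def)
qed

text \<open>Both sides vanish at \<open>a = 1\<close>, which explains the constant 13. The step
  applies \<open>sqrt_step\<close> at \<open>x = 8 a - 7\<close>.\<close>

lemma sum_min_size_ge:
  "a \<ge> 1 \<Longrightarrow> (\<Sum>B<a. real (min_size B)) \<ge> 1 / 24 * ((8 * real a - 7) powr (3/2) + 12 * real a - 13)"
proof (induction a rule: nat_induct_at_least)
  case base
  then show ?case by simp
next
  case (Suc a)
  have "(8 * real a - 7 + 8) powr (3/2) - (8 * real a - 7) powr (3/2) \<le> 12 * sqrt (8 * real a - 7 + 8)"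
    using Suc.hyps by (intro sqrt_step) simp
  then show ?case using Suc.IH min_size_ge[OF Suc.hyps] by (simp add: field_simps)
qed

subsection \<open>The upper bound\<close>

text \<open>Holds whenever \<open>B\<close> is a sum of binomials \<open>n choose 2\<close> whose
  indices \<open>n\<close> add up to \<open>A\<close>; quantifying over \<open>a\<close> and
  \<open>b\<close> avoids carrying the list of indices.\<close>

definition representable :: "nat \<Rightarrow> nat \<Rightarrow> bool" where
  "representable A B \<longleftrightarrow> (\<forall>a b. A * a + B * b \<in> S a b)"

lemma representable_choose: "representable n (n choose 2)"
  unfolding representable_def using generator_in_S by blast

lemma representable_add:
  assumes "representable A B" "representable A' B'"
  shows "representable (A + A') (B + B')"
  unfolding representable_def
proof (intro allI)
  fix a b
  have "(A * a + B * b) + (A' * a + B' * b) \<in> S a b"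
    using assms submonoid_nat_S unfolding representable_def submonoid_nat_def by blast
  then show "(A + A') * a + (B + B') * b \<in> S a b" by (simp add: algebra_simps)
qed

text \<open>The instances of Gauss's theorem that start the recursion. The triples are listed in the
  order of \<open>B\<close>; an index 1 contributes 0.\<close>

lemma small_sum_three_choose:
  assumes "B < 36"
  obtains i j k :: nat where "B = (i choose 2) + (j choose 2) + (k choose 2)"
proof -
  let ?f = "\<lambda>(i, j, k). (i choose 2) + (j choose 2) + (k choose 2)"
  let ?ts = "[(1,1,1), (1,1,2), (1,2,2), (2,2,2), (1,2,3), (2,2,3), (1,3,3), (2,3,3), (2,2,4),
      (3,3,3), (2,3,4), (1,2,5), (3,3,4), (2,4,4), (2,3,5), (3,4,4), (3,3,5), (2,4,5),
      (4,4,4), (3,4,5), (1,5,5), (2,5,5), (4,4,5), (3,5,5), (3,4,6), (1,5,6), (4,5,5),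
      (4,4,6), (3,5,6), (1,2,8), (5,5,5), (4,5,6), (2,5,7), (3,6,6), (3,5,7), (5,5,6)]
      :: (nat \<times> nat \<times> nat) list"
  have "map ?f ?ts = [0..<36]" by (simp add: choose_two upt_conv_Cons)
  then have "B \<in> ?f ` set ?ts" using assms
    by (metis atLeastLessThan_iff list.set_map set_upt zero_le)
  then obtain t where "B = ?f t" by blast
  then show ?thesis using that by (cases t) auto
qed

lemma exists_largest_choose_two:
  obtains n r where "B = (n choose 2) + r" "r < n \<or> B = 0"
proof -
  \<comment> \<open>\<open>min_size (Suc B)\<close> is the first index whose binomial exceeds
    \<open>B\<close>, so its predecessor gives the largest binomial up to \<open>B\<close>. The next
    binomial is larger by \<open>n\<close>, hence the remainder is below \<open>n\<close>.\<close>
  define n where "n = min_size (Suc B) - 1"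
  have pos: "min_size (Suc B) \<noteq> 0"
    using le_choose_min_size[of "Suc B"] by (intro notI) (simp add: binomial_eq_0)
  then have "\<not> min_size (Suc B) \<le> n" by (simp add: n_def)
  then have lo: "n choose 2 \<le> B" using min_size_le[of "Suc B" n] by linarith
  have "Suc B \<le> (n + 1) choose 2" using le_choose_min_size[of "Suc B"] pos by (simp add: n_def)
  then have "B - (n choose 2) < n" using lo choose_two_add[of n 1] by (simp add: binomial_eq_0)
  with lo that[of n "B - (n choose 2)"] show ?thesis by simp
qed

lemma exists_representable:
  "\<exists>A. representable A B \<and> 2 * real A - 3 \<le> sqrt (3 * (8 * real B + 3))"
proof (induction B rule: less_induct)
  case (less B)
  show ?case
  proof (cases "B < 36")
    case True
    then obtain i j k where B: "B = (i choose 2) + (j choose 2) + (k choose 2)"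
      using small_sum_three_choose by blast
    have "representable (i + j + k) B"
      unfolding B by (intro representable_add representable_choose)
    moreover have "(2 * real (i + j + k) - 3)\<^sup>2 \<le> 3 * (8 * real B + 3)"
    proof -
      \<comment> \<open>Cauchy-Schwarz for \<open>2 i - 1\<close>, \<open>2 j - 1\<close>,
        \<open>2 k - 1\<close>: their squares add up to \<open>8 B + 3\<close>, and they themselves
        to \<open>2 (i + j + k) - 3\<close>.\<close>
      have "3 * (8 * real B + 3) - (2 * real (i + j + k) - 3)\<^sup>2
        = 4 * ((real i - real j)\<^sup>2 + (real j - real k)\<^sup>2 + (real i - real k)\<^sup>2)"
        by (simp add: B choose_two_real power2_eq_square field_simps)
      also have "\<dots> \<ge> 0" by simp
      finally show ?thesis by simp
    qed
    ultimately show ?thesis using real_le_rsqrt by blast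
  next
    case False
    obtain n r where n: "B = (n choose 2) + r" "r < n"
      using exists_largest_choose_two[of B] False by (metis zero_less_numeral)
    \<comment> \<open>With \<open>n <= 8\<close> and \<open>r < n\<close>, \<open>B\<close> is at
      most \<open>28 + 7 = 35\<close>; this is where the threshold 36 comes from.\<close>
    have "n \<ge> 9"
    proof (rule ccontr)
      assume "\<not> n \<ge> 9"
      then have "n choose 2 \<le> 8 choose 2" by (intro binomial_right_mono) simp
      moreover have "(8::nat) choose 2 = 28" by (simp add: choose_two)
      ultimately show False using n False \<open>\<not> n \<ge> 9\<close> by linarith
    qed
    \<comment> \<open>This gives \<open>r < B\<close>, so the induction hypothesis applies to
      \<open>r\<close>.\<close>
    then have "n choose 2 > 0" by (simp add: zero_less_binomial)
    then obtain A where A: "representable A r" "2 * real A - 3 \<le> sqrt (3 * (8 * real r + 3))"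
      using less[of r] n by auto
    define s where "s = sqrt (3 * (8 * real r + 3))"
    have s2: "s\<^sup>2 = 3 * (8 * real r + 3)" by (simp add: s_def)
    \<comment> \<open>The goal \<open>(2 n + s)^2 <= 3 (8 B + 3)\<close> reduces to this after
      cancelling \<open>s^2\<close> and dividing by \<open>4 n\<close>.\<close>
    have "s \<le> 2 * real n - 3" unfolding s_def
    proof (rule real_le_lsqrt)
      show "0 \<le> 2 * real n - 3" using \<open>n \<ge> 9\<close> by simp
      have "(2 * real n - 3)\<^sup>2 - 3 * (8 * real r + 3)
          = 4 * (real n * (real n - 9)) + 24 * (real n - real r)"
        by (simp add: power2_eq_square algebra_simps)
      also have "\<dots> \<ge> 0" using \<open>n \<ge> 9\<close> n(2) by simp
      finally show "3 * (8 * real r + 3) \<le> (2 * real n - 3)\<^sup>2" by simp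
    qed
    then have "real n * s \<le> real n * (2 * real n - 3)" by (intro mult_left_mono) auto
    then have "(2 * real n + s)\<^sup>2 \<le> 3 * (8 * real B + 3)"
      using s2 by (simp add: n(1) choose_two_real power2_eq_square field_simps)
    then have "2 * real n + s \<le> sqrt (3 * (8 * real B + 3))" by (rule real_le_rsqrt)
    then have "2 * real (n + A) - 3 \<le> sqrt (3 * (8 * real B + 3))" using A(2) by (simp add: s_def)
    moreover have "representable (n + A) B"
      unfolding n(1) by (intro representable_add representable_choose A(1))
    ultimately show ?thesis by blast
  qed
qed

text \<open>\<open>u B * a + B * b\<close> lies in \<open>S a b\<close>, and so does every larger
  member of its class, since \<open>a\<close> itself is a generator.\<close>

lemma gaps_subset_class_gaps:
  assumes "coprime a b" "a \<ge> 1" "\<And>B. representable (u B) B"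
  shows "UNIV - S a b \<subseteq> class_gaps a b u"
proof
  fix x assume x: "x \<in> UNIV - S a b"
  have "x mod a \<in> (\<lambda>B. (b * B) mod a) ` {..<a}"
    using bij_betw_imp_surj_on[OF bij_betw_mult_mod[OF assms(1,2)]] assms(2) by simp
  then obtain B where B: "B < a" "x mod a = (b * B) mod a" by auto
  have "x < u B * a + b * B"
  proof (rule ccontr)
    let ?m = "u B * a + B * b"
    assume "\<not> x < u B * a + b * B"
    then have le: "?m \<le> x" by (simp add: mult.commute)
    moreover have "x mod a = ?m mod a" using B(2) by (simp add: mult.commute)
    ultimately obtain k where "x - ?m = a * k" by (metis mod_eq_dvd_iff_nat dvdE)
    then have k: "x = ?m + k * a" using le by (simp add: mult.commute)
    have "a \<in> S a b" using generator_in_S[of 1 a b] by (simp add: binomial_eq_0)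
    then have "k * a \<in> S a b" by (rule submonoid_nat_mult[OF submonoid_nat_S])
    moreover have "?m \<in> S a b" using assms(3) by (simp add: representable_def)
    ultimately have "x \<in> S a b"
      using submonoid_nat_S unfolding k submonoid_nat_def by blast
    with x show False by simp
  qed
  with B show "x \<in> class_gaps a b u" by (auto simp: class_gaps_def cong_def)
qed

text \<open>With \<open>u 0 = 0\<close> both sides vanish at \<open>a = 1\<close>, which fixes the
  constants 36 and \<open>11 * sqrt 33\<close>. The step applies \<open>sqrt_step\<close> at
  \<open>x = 8 a + 3\<close>, scaled by \<open>sqrt 3\<close>.\<close>

lemma sum_le_of_sqrt_bound:
  fixes u :: "nat \<Rightarrow> nat"
  assumes "u 0 = 0" "\<And>B. B \<ge> 1 \<Longrightarrow> 2 * real (u B) - 3 \<le> sqrt (3 * (8 * real B + 3))"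
  shows "a \<ge> 1 \<Longrightarrow> (\<Sum>B<a. real (u B)) \<le>
    1 / 24 * (sqrt 3 * (8 * real a + 3) powr (3/2) + 36 * real a - 36 - 11 * sqrt 33)"
proof (induction a rule: nat_induct_at_least)
  case base
  have "(11::real) powr (3/2) = 11 powr 1 * 11 powr (1/2)"
    unfolding powr_add[symmetric] by simp
  then have "sqrt 3 * (11::real) powr (3/2) = 11 * sqrt 33"
    by (simp add: powr_half_sqrt flip: real_sqrt_mult)
  then show ?case using assms(1) by simp
next
  case (Suc a)
  have "12 * sqrt (8 * real a + 3) \<le> (8 * real a + 3 + 8) powr (3/2) - (8 * real a + 3) powr (3/2)"
    by (intro sqrt_step) simp
  then have "sqrt 3 * (12 * sqrt (8 * real a + 3)) \<le>
      sqrt 3 * ((8 * real a + 3 + 8) powr (3/2) - (8 * real a + 3) powr (3/2))"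
    by (intro mult_left_mono) auto
  moreover have "2 * real (u a) - 3 \<le> sqrt 3 * sqrt (8 * real a + 3)"
    using assms(2)[OF Suc.hyps] by (simp only: real_sqrt_mult)
  ultimately show ?case using Suc.IH by (simp add: algebra_simps)
qed

theorem theorem8p4:
  fixes a b :: nat
  assumes "a \<ge> 1" and "b \<ge> 1" and "gcd a b = 1"
    and "(a, b) \<notin> {(29,1), (45,1), (47,1), (50,1), (55,1), (67,1), (73,1), (79,1)}"
  shows "real (genus (S a b)) \<ge>
           1 / 24 * ((8 * real a - 7) powr (3/2) + 12 * real a - 13)
           + (real a - 1) * (real b - 1) / 2 \<and>
         real (genus (S a b)) \<le>
           1 / 24 * (sqrt 3 * (8 * real a + 3) powr (3/2) + 36 * real a - 36 - 11 * sqrt 33)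
           + (real a - 1) * (real b - 1) / 2"
proof -
  have cop: "coprime a b" using assms(3) by (simp add: coprime_iff_gcd_eq_1)
  have fin: "finite (UNIV - S a b)"
    using numerical_semigroup_S_iff[of a b] assms(3) unfolding numerical_semigroup_def by simp
  obtain u' where u': "\<And>B. representable (u' B) B"
    "\<And>B. 2 * real (u' B) - 3 \<le> sqrt (3 * (8 * real B + 3))"
    using exists_representable by metis
  \<comment> \<open>The square root bound at 0 only gives \<open>u' 0 <= 3\<close>; the value 0 is
    needed for the base case of the summation.\<close>
  define u where "u = u'(0 := 0)"
  have "representable 0 0" using representable_choose[of 0] by (simp add: binomial_eq_0)
  then have rep: "representable (u B) B" for B using u'(1) by (simp add: u_def)
  have "real (card (class_gaps a b min_size)) \<le> real (genus (S a b))"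
    unfolding genus_def of_nat_le_iff by (rule card_mono[OF fin class_gaps_subset[OF cop]])
  moreover have "real (genus (S a b)) \<le> real (card (class_gaps a b u))"
    unfolding genus_def of_nat_le_iff
    by (rule card_mono[OF class_gaps_finite_card(1)[OF cop assms(1)]
          gaps_subset_class_gaps[OF cop assms(1) rep]])
  moreover have "(\<Sum>B<a. real (u B)) \<le>
      1 / 24 * (sqrt 3 * (8 * real a + 3) powr (3/2) + 36 * real a - 36 - 11 * sqrt 33)"
    using assms(1) u'(2) by (intro sum_le_of_sqrt_bound) (auto simp: u_def)
  ultimately show ?thesis
    unfolding class_gaps_finite_card(2)[OF cop assms(1)]
    using sum_min_size_ge[OF assms(1)] by (intro conjI; linarith)
qed

end
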